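(* A regular tournament is quadrangular if and only if it is out-quadrangular, and if and only if it is in-quadrangular. (Equivalently: for a regular tournament, being out-quadrangular, being in-quadrangular, and being quadrangular are all equivalent.)
   Context: A tournament is a loopless digraph in which for each pair of distinct vertices exactly one of $(u,v)$, $(v,u)$ is an arc; it is regular if all vertices have the same out-degree (so it has $2k+1$ vertices, each of out-degree $k$). $O(v)$ is the set of vertices $v$ beats and $I(v)$ the set of vertices beating $v$. A digraph is quadrangular if for all distinct $u,v$, $|O(u)\cap O(v)|\neq 1$ and $|I(u)\cap I(v)|\neq 1$; out-quadrangular if the first condition holds for all distinct $u,v$; in-quadrangular if the second does. *)

theory Defs
  imports "Graph_Theory.Digraph"
begin

locale tournament = digraph +
  assumes exactly_one_arc:
    "\<lbrakk>u \<in> verts G; v \<in> verts G; u \<noteq> v\<rbrakk> \<Longrightarrow> (u \<rightarrow> v) \<longleftrightarrow> \<not> (v \<rightarrow> u)"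

locale regular_tournament = tournament +
  assumes regular: "\<exists>k. \<forall>v\<in>verts G. out_degree G v = k"

definition out_set :: "('a, 'b) pre_digraph \<Rightarrow> 'a \<Rightarrow> 'a set" where
  "out_set G v = {w \<in> verts G. v \<rightarrow>\<^bsub>G\<^esub> w}"

definition in_set :: "('a, 'b) pre_digraph \<Rightarrow> 'a \<Rightarrow> 'a set" where
  "in_set G v = {w \<in> verts G. w \<rightarrow>\<^bsub>G\<^esub> v}"

text \<open>In the next three definitions the cardinalities are meaningful for finite digraphs only:
  \<^const>\<open>card\<close> is 0 on infinite sets.\<close>

definition out_quadrangular :: "('a, 'b) pre_digraph \<Rightarrow> bool" where
  "out_quadrangular G \<longleftrightarrow>
    (\<forall>u\<in>verts G. \<forall>v\<in>verts G. u \<noteq> v \<longrightarrow> card (out_set G u \<inter> out_set G v) \<noteq> 1)"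

definition in_quadrangular :: "('a, 'b) pre_digraph \<Rightarrow> bool" where
  "in_quadrangular G \<longleftrightarrow>
    (\<forall>u\<in>verts G. \<forall>v\<in>verts G. u \<noteq> v \<longrightarrow> card (in_set G u \<inter> in_set G v) \<noteq> 1)"

definition quadrangular :: "('a, 'b) pre_digraph \<Rightarrow> bool" where
  "quadrangular G \<longleftrightarrow>
    (\<forall>u\<in>verts G. \<forall>v\<in>verts G. u \<noteq> v \<longrightarrow>
      card (out_set G u \<inter> out_set G v) \<noteq> 1 \<and> card (in_set G u \<inter> in_set G v) \<noteq> 1)"

end

theory Submission
  imports Defs
begin

text \<open>Double counting the arcs of a regular tournament on \<open>n\<close> vertices with out-degree \<open>k\<close> gives
  \<open>n - 1 = 2 k\<close>. If \<open>u\<close> beats \<open>v\<close>, then \<open>O(u) \<union> O(v)\<close> omits exactly \<open>u\<close> and the vertices of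
  \<open>I(u) \<inter> I(v)\<close>, so inclusion-exclusion yields
  \<open>\<bar>O(u) \<inter> O(v)\<bar> = 2 k - (n - 1 - \<bar>I(u) \<inter> I(v)\<bar>) = \<bar>I(u) \<inter> I(v)\<bar>\<close>.\<close>

text \<open>Without parallel arcs, \<open>head\<close> maps the out-arcs of \<open>v\<close>
  bijectively onto the vertices that \<open>v\<close> beats.\<close>

lemma (in digraph) out_degree_eq_card_out_set: "out_degree G v = card (out_set G v)"
proof -
  have "inj_on (head G) (out_arcs G v)"
    using no_multi_arcs by (auto simp: inj_on_def in_out_arcs_conv arc_to_ends_def)
  moreover have "head G ` out_arcs G v = out_set G v"
    by (force simp: out_set_def in_out_arcs_conv arcs_ends_def arc_to_ends_def)
  ultimately show ?thesis
    unfolding out_degree_def by (metis card_image)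
qed

text \<open>Both sums count the adjacent ordered pairs, grouped by tail or by head.\<close>

lemma (in fin_digraph) sum_card_out_set_eq_sum_card_in_set:
  "(\<Sum>v\<in>verts G. card (out_set G v)) = (\<Sum>v\<in>verts G. card (in_set G v))"
  unfolding out_set_def in_set_def card_eq_sum
  by (rule sum.swap_restrict) simp_all

context tournament
begin

lemma not_dominates_self: "\<not> v \<rightarrow> v"
  using adj_not_same by blast

lemma verts_minus_vertex:
  assumes "v \<in> verts G"
  shows "verts G - {v} = out_set G v \<union> in_set G v"
  using assms exactly_one_arc not_dominates_self by (auto simp: out_set_def in_set_def)

lemma card_out_set_plus_card_in_set:
  assumes "v \<in> verts G"
  shows "card (out_set G v) + card (in_set G v) = card (verts G) - 1"
proof -
  have "out_set G v \<inter> in_set G v = {}"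
    using assms exactly_one_arc not_dominates_self by (auto simp: out_set_def in_set_def)
  then have "card (out_set G v \<union> in_set G v) = card (out_set G v) + card (in_set G v)"
    by (intro card_Un_disjoint) (auto simp: out_set_def in_set_def)
  then show ?thesis
    using assms verts_minus_vertex[OF assms] by (metis card_Diff_singleton)
qed

text \<open>A third vertex beaten by neither \<open>u\<close> nor \<open>v\<close> beats both. Of
  the two themselves, \<open>v\<close> lies in O(u), while \<open>u\<close> is beaten by
  neither.\<close>

lemma out_set_Un_out_set:
  assumes "u \<in> verts G" "v \<in> verts G" "u \<rightarrow> v"
  shows "out_set G u \<union> out_set G v = verts G - insert u (in_set G u \<inter> in_set G v)"
proof -
  have "u \<noteq> v"
    using assms not_dominates_self by blast
  then show ?thesis
    using assms exactly_one_arc not_dominates_self unfolding out_set_def in_set_def by blast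
qed

end

context regular_tournament
begin

lemma card_verts_eq_twice_card_out_set:
  assumes "v \<in> verts G"
  shows "card (verts G) = 2 * card (out_set G v) + 1"
proof -
  obtain k where k: "\<And>w. w \<in> verts G \<Longrightarrow> card (out_set G w) = k"
    using regular out_degree_eq_card_out_set by auto
  have pos: "card (verts G) > 0"
    using assms by (auto simp: card_gt_0_iff)
  have in_card: "card (in_set G w) = card (verts G) - 1 - k" if "w \<in> verts G" for w
    using card_out_set_plus_card_in_set[OF that] k[OF that] by simp
  \<comment> \<open>The left side totals the out-degrees, the right side the in-degrees.\<close>
  have "card (verts G) * k = card (verts G) * (card (verts G) - 1 - k)"
    using sum_card_out_set_eq_sum_card_in_set k in_card by simp
  then have "k = card (verts G) - 1 - k"
    using pos by auto
  moreover have "k \<le> card (verts G) - 1"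
    using card_out_set_plus_card_in_set[OF assms] k[OF assms] by simp
  ultimately show ?thesis
    using pos k[OF assms] by simp
qed

lemma card_out_set_Int_eq_card_in_set_Int:
  assumes "u \<in> verts G" "v \<in> verts G" "u \<noteq> v"
  shows "card (out_set G u \<inter> out_set G v) = card (in_set G u \<inter> in_set G v)"
proof -
  have *: "card (out_set G x \<inter> out_set G y) = card (in_set G x \<inter> in_set G y)"
    if xy: "x \<in> verts G" "y \<in> verts G" "x \<rightarrow> y" for x y
  proof -
    let ?I = "in_set G x \<inter> in_set G y"
    have fin: "finite ?I" "finite (out_set G x)" "finite (out_set G y)"
      by (auto simp: in_set_def out_set_def)
    have sub: "insert x ?I \<subseteq> verts G" and "x \<notin> ?I"
      using xy not_dominates_self by (auto simp: in_set_def)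
    then have card_insert: "card (insert x ?I) = card ?I + 1"
      using fin by simp
    \<comment> \<open>This bound keeps the natural-number subtraction in the next step from
      truncating.\<close>
    then have le: "card ?I + 1 \<le> card (verts G)"
      using card_mono[OF finite_verts sub] by simp
    have "card (out_set G x \<union> out_set G y) = card (verts G) - (card ?I + 1)"
      using out_set_Un_out_set[OF xy] card_Diff_subset[OF _ sub] fin card_insert by simp
    \<comment> \<open>O(x) and O(y) each have half of n - 1 elements, so their sizes add up to n -
      1, where n is the number of vertices.\<close>
    then show ?thesis
      using card_Un_Int[OF fin(2,3)] le
        card_verts_eq_twice_card_out_set[OF xy(1)] card_verts_eq_twice_card_out_set[OF xy(2)]
      by linarith
  qed
  \<comment> \<open>Both sides are symmetric in \<open>u\<close> and \<open>v\<close>, so the one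
    that beats the other can be taken as \<open>x\<close>.\<close>
  show ?thesis
    using *[of u v] *[of v u] assms exactly_one_arc by (metis Int_commute)
qed

end

theorem theorem15:
  fixes G :: "('a, 'b) pre_digraph"
  assumes "regular_tournament G"
  shows "(quadrangular G \<longleftrightarrow> out_quadrangular G) \<and> (quadrangular G \<longleftrightarrow> in_quadrangular G)"
  \<comment> \<open>The out- and in-conditions coincide for each pair of distinct vertices.\<close>
  using regular_tournament.card_out_set_Int_eq_card_in_set_Int[OF assms]
  unfolding quadrangular_def out_quadrangular_def in_quadrangular_def by auto

end
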